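(* Let $E$ be a real linear space, $\psi:E\to\mathbb{R}$ a seminorm, and $K, A\subseteq E$ nontrivial cones with normlike-bases $B_K$ and $B_A$ (with respect to $\psi$). Define $S_{-K}:=\mathrm{conv}(-B_K)$ and $S_A^0:=\mathrm{conv}(B_A\cup\{0\})$. If one of the following conditions holds: (i) $S_{-K}$ is solid and $S_A^0\cap \mathrm{cor}\,S_{-K}=\emptyset$; (ii) $S_A^0$ is solid and $(\mathrm{cor}\,S_A^0)\cap S_{-K}=\emptyset$; (iii) $S_{-K}$ and $S_A^0$ are relatively solid and $(\mathrm{icor}\,S_A^0)\cap(\mathrm{icor}\,S_{-K})=\emptyset$; then there exists $(x',\alpha)\in K^{a+}$ with $x'\neq 0$ such that $$x'(a)+\alpha\psi(a)\ \geq\ 0\ \geq\ x'(k)+\alpha\psi(k)\quad\text{for all } a\in A \text{ and } k\in -K.$$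
   Context: $E\neq\{0\}$ is a real linear space with algebraic dual $E'$; $\mathbb{R}_+=[0,\infty)$. A set $K\subseteq E$ is a cone if $0\in K=\mathbb{R}_+\cdot K$ (not necessarily convex); it is nontrivial if $\{0\}\neq K\neq E$. A seminorm is a sublinear symmetric function $\psi:E\to\mathbb{R}$. A nontrivial cone $K$ has a normlike-base (w.r.t. $\psi$) if $\psi(x)>0$ for all $x\in K\setminus\{0\}$; the normlike-base is then $B_K:=\{x\in K\mid \psi(x)=1\}$. All normlike-bases are taken with respect to the same fixed seminorm $\psi$. For $\Omega\subseteq E$: $\mathrm{cor}\,\Omega:=\{x\in\Omega\mid \forall v\in E\ \exists\varepsilon>0:\ x+[0,\varepsilon]\cdot v\subseteq\Omega\}$ and $\mathrm{icor}\,\Omega:=\{x\in\Omega\mid \forall v\in \mathrm{aff}(\Omega-\Omega)\ \exists\varepsilon>0:\ x+[0,\varepsilon]\cdot v\subseteq\Omega\}$, where $\mathrm{aff}$ denotes the affine hull; $\Omega$ is solid if $\mathrm{cor}\,\Omega\neq\emptyset$ and relatively solid if $\mathrm{icor}\,\Omega\neq\emptyset$. $\mathrm{conv}$ denotes the convex hull. $K^+:=\{y'\in E'\mid \forall k\in K:\ y'(k)\geq 0\}$ and $K^{a+}:=\{(x',\alpha)\in K^+\times\mathbb{R}_+\mid \forall y\in K:\ x'(y)-\alpha\psi(y)\geq 0\}$. *)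

theory Defs
  imports "HOL-Analysis.Analysis"
begin

definition seminorm :: "('a::real_vector \<Rightarrow> real) \<Rightarrow> bool" where
  "seminorm \<psi> \<longleftrightarrow>
     (\<forall>x y. \<psi> (x + y) \<le> \<psi> x + \<psi> y) \<and>
     (\<forall>t x. 0 \<le> t \<longrightarrow> \<psi> (t *\<^sub>R x) = t * \<psi> x) \<and>
     (\<forall>x. \<psi> (- x) = \<psi> x)"

(* The library's cone predicate also holds of the empty set. Together with 0 \<in> K it says
   0 \<in> K = [0,\<infinity>) \<cdot> K; the inclusion of K in [0,\<infinity>) \<cdot> K is automatic (factor 1). *)
definition nontrivial_cone :: "'a::real_vector set \<Rightarrow> bool" where
  "nontrivial_cone K \<longleftrightarrow> cone K \<and> 0 \<in> K \<and> K \<noteq> {0} \<and> K \<noteq> UNIV"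

definition has_normlike_base :: "('a::real_vector \<Rightarrow> real) \<Rightarrow> 'a set \<Rightarrow> bool" where
  "has_normlike_base \<psi> K \<longleftrightarrow> (\<forall>x \<in> K - {0}. 0 < \<psi> x)"

definition normlike_base :: "('a::real_vector \<Rightarrow> real) \<Rightarrow> 'a set \<Rightarrow> 'a set" where
  "normlike_base \<psi> K = {x \<in> K. \<psi> x = 1}"

definition cor :: "'a::real_vector set \<Rightarrow> 'a set" where
  "cor \<Omega> = {x \<in> \<Omega>. \<forall>v. \<exists>\<epsilon>>0. \<forall>t \<in> {0..\<epsilon>}. x + t *\<^sub>R v \<in> \<Omega>}"

definition icor :: "'a::real_vector set \<Rightarrow> 'a set" where
  "icor \<Omega> = {x \<in> \<Omega>. \<forall>v \<in> affine hull {y - z | y z. y \<in> \<Omega> \<and> z \<in> \<Omega>}.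
                        \<exists>\<epsilon>>0. \<forall>t \<in> {0..\<epsilon>}. x + t *\<^sub>R v \<in> \<Omega>}"

definition solid :: "'a::real_vector set \<Rightarrow> bool" where
  "solid \<Omega> \<longleftrightarrow> cor \<Omega> \<noteq> {}"

definition relatively_solid :: "'a::real_vector set \<Rightarrow> bool" where
  "relatively_solid \<Omega> \<longleftrightarrow> icor \<Omega> \<noteq> {}"

(* The algebraic dual consists of all linear functionals; no continuity is involved. *)
definition algebraic_dual :: "('a::real_vector \<Rightarrow> real) set" where
  "algebraic_dual = {f. linear f}"

definition dual_cone :: "'a::real_vector set \<Rightarrow> ('a \<Rightarrow> real) set" where
  "dual_cone K = {f \<in> algebraic_dual. \<forall>k \<in> K. 0 \<le> f k}"

definition aug_dual_cone ::
    "('a::real_vector \<Rightarrow> real) \<Rightarrow> 'a set \<Rightarrow> (('a \<Rightarrow> real) \<times> real) set" where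
  "aug_dual_cone \<psi> K =
     {(f, \<alpha>). f \<in> dual_cone K \<and> 0 \<le> \<alpha> \<and> (\<forall>y \<in> K. 0 \<le> f y - \<alpha> * \<psi> y)}"

definition S_neg :: "('a::real_vector \<Rightarrow> real) \<Rightarrow> 'a set \<Rightarrow> 'a set" where
  "S_neg \<psi> K = convex hull (uminus ` normlike_base \<psi> K)"

definition S_zero :: "('a::real_vector \<Rightarrow> real) \<Rightarrow> 'a set \<Rightarrow> 'a set" where
  "S_zero \<psi> A = convex hull (normlike_base \<psi> A \<union> {0})"

end

theory Submission
  imports Defs
begin

text \<open>A functional \<open>f\<close> separating \<open>S_zero \<psi> A\<close> from \<open>S_neg \<psi> K\<close> has nonpositive infimum \<open>-\<alpha>\<close> on
  \<open>S_zero \<psi> A\<close> because of the point \<open>0\<close>. On the bases \<open>\<psi> = 1\<close>, so the separation reads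
  \<open>f + \<alpha> \<psi> \<ge> 0\<close> and \<open>f + \<alpha> \<psi> \<le> 0\<close> there, and both extend to the cones by homogeneity.
  The separating functional comes from a convex cone that is maximal among those containing an
  algebraically open convex set and avoiding one given point.\<close>

section \<open>Maximal convex cones avoiding a point\<close>

text \<open>Zorn's lemma applied to the convex cones that contain \<open>D\<close> and avoid
  \<open>- c\<close>. The last conclusion is maximality in a usable form: adjoining any outside
  point \<open>x\<close> produces \<open>- c\<close>.\<close>

lemma maximal_convex_cone:
  fixes D :: "'a::real_vector set"
  assumes "convex D" "c \<in> D" "0 \<notin> D"
  obtains M where "convex_cone M" "D \<subseteq> M" "- c \<notin> M"
    "\<And>x. x \<notin> M \<Longrightarrow> \<exists>m\<in>M. \<exists>r>0. - c = m + r *\<^sub>R x"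
proof -
  define \<A> where "\<A> = {M. convex_cone M \<and> D \<subseteq> M \<and> - c \<notin> M}"
  have hull: "convex_cone hull D = {a *\<^sub>R x |a x. 0 \<le> a \<and> x \<in> D}"
    using convex_cone_hull_convex_hull_nonempty[of D] assms by (auto simp: hull_same)
  have "- c \<notin> convex_cone hull D"
  proof
    assume "- c \<in> convex_cone hull D"
    then obtain a x where a: "0 \<le> a" "x \<in> D" "- c = a *\<^sub>R x"
      unfolding hull by blast
    \<comment> \<open>These weights turn \<open>c + a *\<^sub>R x = 0\<close> into a convex
      combination of two points of \<open>D\<close>, which puts \<open>0\<close> into
      \<open>D\<close>.\<close>
    have "(1 / (1 + a)) *\<^sub>R c + (a / (1 + a)) *\<^sub>R x \<in> D"
      using a assms by (intro convexD) (auto simp: field_simps)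
    also have "(1 / (1 + a)) *\<^sub>R c + (a / (1 + a)) *\<^sub>R x = (1 / (1 + a)) *\<^sub>R (c + a *\<^sub>R x)"
      by (simp add: scaleR_add_right)
    also have "\<dots> = 0" using a(3) by (metis add.right_inverse scaleR_zero_right)
    finally show False using assms by simp
  qed
  then have "convex_cone hull D \<in> \<A>"
    by (simp add: \<A>_def convex_cone_convex_cone_hull hull_subset)
  then have ne: "\<A> \<noteq> {}" by blast
  have un: "\<Union>\<C> \<in> \<A>" if "\<C> \<noteq> {}" "subset.chain \<A> \<C>" for \<C>
  proof -
    have C: "\<C> \<subseteq> \<A>" and tot: "X \<subseteq> Y \<or> Y \<subseteq> X" if "X \<in> \<C>" "Y \<in> \<C>" for X Y
      using \<open>subset.chain \<A> \<C>\<close> that by (auto simp: subset_chain_def)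
    have mem: "convex_cone X" "D \<subseteq> X" "- c \<notin> X" if "X \<in> \<C>" for X
      using C[OF that that] that unfolding \<A>_def by auto
    have "x + y \<in> \<Union>\<C>" if xy: "x \<in> \<Union>\<C>" "y \<in> \<Union>\<C>" for x y
    proof -
      obtain X Y where "X \<in> \<C>" "Y \<in> \<C>" "x \<in> X" "y \<in> Y" using xy by blast
      then obtain Z where "Z \<in> \<C>" "x \<in> Z" "y \<in> Z" using tot[of X Y] by blast
      then show ?thesis using convex_cone_add mem(1) by blast
    qed
    moreover have "a *\<^sub>R x \<in> \<Union>\<C>" if "x \<in> \<Union>\<C>" "0 \<le> a" for x a
      using that mem(1) convex_cone_scaleR by blast
    moreover have "0 \<in> \<Union>\<C>"
      using \<open>\<C> \<noteq> {}\<close> mem(1) convex_cone_contains_0 by blast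
    ultimately have "convex_cone (\<Union>\<C>)" by (auto simp: convex_cone_iff)
    moreover have "D \<subseteq> \<Union>\<C>" "- c \<notin> \<Union>\<C>" using mem \<open>\<C> \<noteq> {}\<close> by blast+
    ultimately show ?thesis by (simp add: \<A>_def)
  qed
  obtain M where M: "M \<in> \<A>" and max: "\<And>X. X \<in> \<A> \<Longrightarrow> M \<subseteq> X \<Longrightarrow> X = M"
    using subset_Zorn_nonempty[OF ne un] by blast
  have Mc: "convex_cone M" "D \<subseteq> M" "- c \<notin> M" using M by (auto simp: \<A>_def)
  have ext: "\<exists>m\<in>M. \<exists>r>0. - c = m + r *\<^sub>R x" if x: "x \<notin> M" for x
  proof -
    \<comment> \<open>The convex cone generated by \<open>M\<close> and \<open>x\<close>. It is
      strictly larger than \<open>M\<close>, so by maximality it must contain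
      \<open>- c\<close>.\<close>
    define N where "N = {m + r *\<^sub>R x |m r. m \<in> M \<and> 0 \<le> r}"
    have inN: "m + r *\<^sub>R x \<in> N" if "m \<in> M" "0 \<le> r" for m r
      using that by (auto simp: N_def)
    have "convex_cone N"
      unfolding convex_cone_iff
    proof (intro conjI ballI allI impI)
      show "0 \<in> N" using inN[of 0 0] Mc(1) by (simp add: convex_cone_contains_0)
    next
      fix y z assume "y \<in> N" "z \<in> N"
      then obtain m r m' r' where *: "m \<in> M" "0 \<le> r" "y = m + r *\<^sub>R x"
        "m' \<in> M" "0 \<le> r'" "z = m' + r' *\<^sub>R x" by (auto simp: N_def)
      then have "y + z = (m + m') + (r + r') *\<^sub>R x" by (simp add: algebra_simps)
      moreover have "(m + m') + (r + r') *\<^sub>R x \<in> N"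
        using * Mc(1) by (intro inN convex_cone_add) auto
      ultimately show "y + z \<in> N" by simp
    next
      fix y and a :: real assume "y \<in> N" "a \<ge> 0"
      then obtain m r where *: "m \<in> M" "0 \<le> r" "y = m + r *\<^sub>R x" by (auto simp: N_def)
      then have "a *\<^sub>R y = a *\<^sub>R m + (a * r) *\<^sub>R x" by (simp add: algebra_simps)
      moreover have "a *\<^sub>R m + (a * r) *\<^sub>R x \<in> N"
        using * \<open>a \<ge> 0\<close> Mc(1) by (intro inN convex_cone_scaleR) auto
      ultimately show "a *\<^sub>R y \<in> N" by simp
    qed
    moreover have sub: "M \<subseteq> N"
    proof
      fix m assume "m \<in> M" then show "m \<in> N" using inN[of m 0] by simp
    qed
    moreover have "x \<in> N" using inN[of 0 1] Mc(1) by (simp add: convex_cone_contains_0)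
    ultimately have "N \<notin> \<A>" using max x by blast
    then have "- c \<in> N" using \<open>convex_cone N\<close> sub Mc by (auto simp: \<A>_def)
    then obtain m r where *: "m \<in> M" "0 \<le> r" "- c = m + r *\<^sub>R x" by (auto simp: N_def)
    moreover have "r \<noteq> 0" using * Mc(3) by auto
    ultimately show ?thesis by (metis order_le_less)
  qed
  show thesis using that[OF Mc ext] .
qed

section \<open>Algebraic interiors relative to a subspace\<close>

text \<open>For a subspace \<open>V\<close>, this is \<open>cor\<close> when \<open>V = UNIV\<close>, \<open>icor\<close> when \<open>V\<close> is the span of the
  differences of \<open>P\<close>, and \<open>P\<close> itself when \<open>V = {0}\<close>; so it covers all three alternatives of the
  theorem at once.\<close>

definition relcor :: "'a::real_vector set \<Rightarrow> 'a set \<Rightarrow> 'a set" where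
  "relcor V P = {x \<in> P. \<forall>v\<in>V. \<exists>\<epsilon>>0. \<forall>t\<in>{0..\<epsilon>}. x + t *\<^sub>R v \<in> P}"

lemma cor_eq_relcor: "cor P = relcor UNIV P"
  by (simp add: cor_def relcor_def)

lemma icor_eq_relcor: "icor P = relcor (affine hull {y - z |y z. y \<in> P \<and> z \<in> P}) P"
  by (simp add: icor_def relcor_def)

lemma relcor_zero [simp]: "relcor {0} P = P"
  by (auto simp: relcor_def intro: exI[of _ 1])

lemma subspace_affine_hull_differences:
  assumes "P \<noteq> {}"
  shows "subspace (affine hull {y - z |y z. y \<in> P \<and> z \<in> P})"
proof -
  have "0 \<in> {y - z |y z. y \<in> P \<and> z \<in> P}" using assms by force
  then show ?thesis by (simp add: affine_hull_span_0 hull_inc)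
qed

section \<open>Functionals that are nonnegative on a convex set avoiding the origin\<close>

text \<open>For the preorder whose positive cone is the maximal cone \<open>M\<close>, the point
  \<open>c\<close> is an order unit. Maximality makes the space the direct sum of \<open>N\<close>,
  the intersection of \<open>M\<close> and \<open>- M\<close>, and the line through
  \<open>c\<close>; \<open>f\<close> is the coordinate along \<open>c\<close>.\<close>

lemma linear_functional_of_open_convex:
  fixes D :: "'a::real_vector set"
  assumes "convex D" "c \<in> D" "0 \<notin> D" and c: "c \<in> relcor UNIV D"
  obtains f :: "'a \<Rightarrow> real" where "linear f" "f c = 1" "\<And>x. x \<in> D \<Longrightarrow> 0 \<le> f x"
proof -
  obtain M where M: "convex_cone M" "D \<subseteq> M" "- c \<notin> M"
    and ext: "\<And>x. x \<notin> M \<Longrightarrow> \<exists>m\<in>M. \<exists>r>0. - c = m + r *\<^sub>R x"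
    using maximal_convex_cone assms by metis
  note add = convex_cone_add[OF M(1)] and scale = convex_cone_scaleR[OF M(1)]
  have cM: "a *\<^sub>R c \<in> M \<longleftrightarrow> 0 \<le> a" for a
  proof
    assume "a *\<^sub>R c \<in> M"
    show "0 \<le> a"
    proof (rule ccontr)
      assume "\<not> 0 \<le> a"
      then show False using scale[of "- 1 / a" "a *\<^sub>R c"] \<open>a *\<^sub>R c \<in> M\<close> M(3) by simp
    qed
  qed (use scale M(2) assms in auto)
  have absorb: "\<exists>b. x + b *\<^sub>R c \<in> M" for x
  proof -
    obtain \<epsilon> where e: "\<epsilon> > 0" "\<forall>t\<in>{0..\<epsilon>}. c + t *\<^sub>R x \<in> D"
      using c unfolding relcor_def by blast
    then have "c + \<epsilon> *\<^sub>R x \<in> M" using M(2) by auto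
    then have "(1 / \<epsilon>) *\<^sub>R (c + \<epsilon> *\<^sub>R x) \<in> M" using scale e(1) by simp
    then show ?thesis using e(1) by (auto simp: scaleR_add_right add.commute)
  qed
  define N where "N = {x \<in> M. - x \<in> M}"
  have N_add: "x + y \<in> N" if "x \<in> N" "y \<in> N" for x y
    using that add[of x y] add[of "- x" "- y"] by (simp add: N_def add.commute)
  have N_neg: "- x \<in> N" if "x \<in> N" for x
    using that by (simp add: N_def)
  have N_scale: "a *\<^sub>R x \<in> N" if "x \<in> N" for x a
    using that scale[of a x] scale[of a "- x"] scale[of "- a" x] scale[of "- a" "- x"]
    by (cases "a \<ge> 0") (auto simp: N_def)
  have ex: "\<exists>t. x - t *\<^sub>R c \<in> N" for x
  proof -
    \<comment> \<open>The coordinate of \<open>x\<close> is \<open>Sup T\<close>. Absorption of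
      \<open>x\<close> makes \<open>T\<close> nonempty and absorption of \<open>- x\<close> bounds
      it above.\<close>
    define T where "T = {t. x - t *\<^sub>R c \<in> M}"
    obtain b where "x + b *\<^sub>R c \<in> M" using absorb by blast
    then have T_ne: "- b \<in> T" by (simp add: T_def)
    obtain d where d: "- x + d *\<^sub>R c \<in> M" using absorb by blast
    have T_bdd: "t \<le> d" if "t \<in> T" for t
    proof -
      have "(- x + d *\<^sub>R c) + (x - t *\<^sub>R c) \<in> M" using that by (intro add d) (simp add: T_def)
      also have "(- x + d *\<^sub>R c) + (x - t *\<^sub>R c) = (d - t) *\<^sub>R c" by (simp add: algebra_simps)
      finally show ?thesis by (simp add: cM)
    qed
    then have bdd: "bdd_above T" by (rule bdd_aboveI)
    define y where "y = x - Sup T *\<^sub>R c"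
    \<comment> \<open>The supremum is attained by maximality, not by a closedness argument: if
      \<open>y\<close> were outside \<open>M\<close>, some \<open>t\<close> in \<open>T\<close>
      closer than \<open>1 / r\<close> to \<open>Sup T\<close> would put a negative multiple of
      \<open>c\<close> into \<open>M\<close>.\<close>
    have "y \<in> M"
    proof (rule ccontr)
      assume "y \<notin> M"
      then obtain m r where mr: "m \<in> M" "r > 0" "- c = m + r *\<^sub>R y" using ext by blast
      obtain t where t: "t \<in> T" "Sup T - 1 / r < t"
        using less_cSup_iff[of T "Sup T - 1 / r"] bdd T_ne mr(2) by auto
      have "m + r *\<^sub>R (x - t *\<^sub>R c) \<in> M"
        using mr t add scale by (simp add: T_def)
      also have "m + r *\<^sub>R (x - t *\<^sub>R c) = (m + r *\<^sub>R y) + (r * (Sup T - t)) *\<^sub>R c"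
        by (simp add: y_def algebra_simps)
      also have "\<dots> = (r * (Sup T - t) - 1) *\<^sub>R c"
        by (simp flip: mr(3) add: algebra_simps)
      finally have "1 \<le> r * (Sup T - t)" by (simp add: cM)
      then show False using t(2) mr(2) by (simp add: field_simps)
    qed
    \<comment> \<open>If \<open>- y\<close> were outside \<open>M\<close>, then
      \<open>y = (1 / r) *\<^sub>R (m + c)\<close>, so \<open>T\<close> would contain a number
      exceeding its supremum by \<open>1 / r\<close>.\<close>
    moreover have "- y \<in> M"
    proof (rule ccontr)
      assume "- y \<notin> M"
      then obtain m r where mr: "m \<in> M" "r > 0" "- c = m + r *\<^sub>R (- y)" using ext by blast
      have "r *\<^sub>R y = m + c" using mr(3) by (simp add: algebra_simps eq_neg_iff_add_eq_0)
      then have "y = (1 / r) *\<^sub>R (m + c)"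
        using mr(2) by (metis divide_self less_irrefl mult.commute scaleR_one scaleR_scaleR
            times_divide_eq_left mult_1)
      then have "x - (Sup T + 1 / r) *\<^sub>R c = (1 / r) *\<^sub>R m"
        by (simp add: y_def algebra_simps)
      then have "Sup T + 1 / r \<in> T" using scale[of "1 / r" m] mr by (simp add: T_def)
      then show False using cSup_upper[OF _ bdd] mr(2) by fastforce
    qed
    ultimately show ?thesis unfolding y_def N_def by blast
  qed
  have uniq: "s = t" if "x - s *\<^sub>R c \<in> N" "x - t *\<^sub>R c \<in> N" for x s t
  proof -
    have "(x - s *\<^sub>R c) + - (x - t *\<^sub>R c) \<in> N" using that N_add N_neg by blast
    also have "(x - s *\<^sub>R c) + - (x - t *\<^sub>R c) = (t - s) *\<^sub>R c" by (simp add: algebra_simps)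
    finally have "(t - s) *\<^sub>R c \<in> M" "(s - t) *\<^sub>R c \<in> M"
      by (auto simp: N_def simp flip: scaleR_minus_left)
    then show ?thesis by (simp add: cM)
  qed
  obtain f where f: "x - f x *\<^sub>R c \<in> N" for x using ex by metis
  have f_eq: "f x = t" if "x - t *\<^sub>R c \<in> N" for x t using uniq[OF f that] .
  have "linear f"
  proof (rule linearI)
    fix x y
    have "(x - f x *\<^sub>R c) + (y - f y *\<^sub>R c) \<in> N" by (intro N_add f)
    then show "f (x + y) = f x + f y" by (intro f_eq) (simp add: algebra_simps)
  next
    fix a x
    have "a *\<^sub>R (x - f x *\<^sub>R c) \<in> N" by (intro N_scale f)
    then show "f (a *\<^sub>R x) = a *\<^sub>R f x" by (intro f_eq) (simp add: algebra_simps)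
  qed
  moreover have "f c = 1"
    using M(1) by (intro f_eq) (simp add: N_def convex_cone_contains_0)
  moreover have "0 \<le> f x" if "x \<in> D" for x
  proof -
    \<comment> \<open>The sum is \<open>f x *\<^sub>R c\<close>, and \<open>M\<close> contains only
      the nonnegative multiples of \<open>c\<close>.\<close>
    have "x + - (x - f x *\<^sub>R c) \<in> M" using that M(2) f[of x] by (intro add) (auto simp: N_def)
    then show ?thesis by (simp add: cM)
  qed
  ultimately show thesis using that by blast
qed

text \<open>\<open>D\<close> lies in the translate of \<open>V\<close> through \<open>c\<close>. If
  \<open>c\<close> is in \<open>V\<close>, then so is \<open>D\<close>, and its preimage under a
  projection onto \<open>V\<close> is a case of the previous lemma. Otherwise a functional that
  vanishes on \<open>V\<close> and is 1 at \<open>c\<close> is constantly 1 on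
  \<open>D\<close>.\<close>

lemma linear_functional_of_relatively_open_convex:
  fixes D :: "'a::real_vector set"
  assumes "convex D" "c \<in> D" "0 \<notin> D" "subspace V"
    and diff: "\<And>x. x \<in> D \<Longrightarrow> x - c \<in> V"
    and open_D: "c \<in> relcor V D"
  obtains f :: "'a \<Rightarrow> real" where "linear f" "f \<noteq> (\<lambda>_. 0)" "\<And>x. x \<in> D \<Longrightarrow> 0 \<le> f x"
proof -
  \<comment> \<open>A left inverse of the identity on \<open>V\<close> with values in
    \<open>V\<close> is a linear projection onto \<open>V\<close>.\<close>
  obtain \<pi> :: "'a \<Rightarrow> 'a" where \<pi>: "linear \<pi>" "\<And>x. \<pi> x \<in> V" "\<And>v. v \<in> V \<Longrightarrow> \<pi> v = v"
    using linear_exists_left_inverse_on[of "\<lambda>x::'a. x" V] \<open>subspace V\<close>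
    by (auto simp: linear_ident)
  show thesis
  proof (cases "c \<in> V")
    case True
    have DV: "x \<in> V" if "x \<in> D" for x
      using subspace_add[OF \<open>subspace V\<close> diff[OF that] True] by simp
    have "convex (\<pi> -` D)" using \<pi>(1) \<open>convex D\<close> by (rule convex_linear_vimage)
    moreover have "c \<in> \<pi> -` D" using \<pi>(3) True \<open>c \<in> D\<close> by simp
    moreover have "0 \<notin> \<pi> -` D" using \<pi>(1) \<open>0 \<notin> D\<close> by (simp add: linear_0)
    \<comment> \<open>A direction \<open>v\<close> of the whole space moves \<open>c\<close> under
      \<open>\<pi>\<close> in the direction \<open>\<pi> v\<close>, which lies in
      \<open>V\<close>.\<close>
    moreover have "c \<in> relcor UNIV (\<pi> -` D)"
      using open_D \<pi>(2) \<pi>(3)[OF True]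
      by (auto simp: relcor_def linear_add[OF \<pi>(1)] linear_scale[OF \<pi>(1)])
    ultimately obtain f :: "'a \<Rightarrow> real"
      where "linear f" "f c = 1" "\<And>x. x \<in> \<pi> -` D \<Longrightarrow> 0 \<le> f x"
      using linear_functional_of_open_convex by blast
    moreover have "D \<subseteq> \<pi> -` D" using DV \<pi>(3) by auto
    ultimately show thesis using that by (metis subsetD zero_neq_one)
  next
    case False
    then have "c - \<pi> c \<noteq> 0" using \<pi>(2)[of c] by auto
    then obtain g :: "'a \<Rightarrow> real" where g: "linear g" "g (c - \<pi> c) = 1"
      using linear_independent_extend[of "{c - \<pi> c}" "\<lambda>_. 1::real"] by auto
    define f where "f = (\<lambda>x. g (x - \<pi> x))"
    have "linear f"
      using linear_compose[OF linear_compose_sub[OF linear_ident \<pi>(1)] g(1)]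
      by (simp add: f_def o_def)
    moreover have "f x = 1" if "x \<in> D" for x
    proof -
      have "\<pi> (x - c) = x - c" using diff[OF that] \<pi>(3) by blast
      then have "x - \<pi> x = c - \<pi> c" by (simp add: linear_diff[OF \<pi>(1)] algebra_simps)
      then show ?thesis using g(2) by (simp add: f_def)
    qed
    ultimately show thesis using that \<open>c \<in> D\<close> by (metis zero_le_one zero_neq_one)
  qed
qed

section \<open>Convexity and openness of relative cores\<close>

text \<open>Mixing with \<open>y\<close> shrinks the room available at \<open>x\<close> in each
  direction by the factor \<open>1 - t\<close>, which stays positive because
  \<open>t < 1\<close>.\<close>

lemma relcor_segment:
  assumes "convex P" "x \<in> relcor V P" "y \<in> P" "0 \<le> t" "t < 1"
  shows "(1 - t) *\<^sub>R x + t *\<^sub>R y \<in> relcor V P"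
proof -
  have xP: "x \<in> P" using assms by (simp add: relcor_def)
  have "\<exists>\<epsilon>>0. \<forall>s\<in>{0..\<epsilon>}. (1 - t) *\<^sub>R x + t *\<^sub>R y + s *\<^sub>R v \<in> P" if "v \<in> V" for v
  proof -
    obtain \<epsilon> where e: "\<epsilon> > 0" "\<forall>s\<in>{0..\<epsilon>}. x + s *\<^sub>R v \<in> P"
      using assms(2) \<open>v \<in> V\<close> unfolding relcor_def by blast
    have "(1 - t) *\<^sub>R x + t *\<^sub>R y + s *\<^sub>R v \<in> P" if s: "s \<in> {0..(1 - t) * \<epsilon>}" for s
    proof -
      have "x + (s / (1 - t)) *\<^sub>R v \<in> P"
        using e(2) s \<open>t < 1\<close> by (auto simp: field_simps)
      then have "(1 - t) *\<^sub>R (x + (s / (1 - t)) *\<^sub>R v) + t *\<^sub>R y \<in> P"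
        using assms by (intro convexD) auto
      then show ?thesis using \<open>t < 1\<close> by (simp add: scaleR_add_right add_ac)
    qed
    moreover have "(1 - t) * \<epsilon> > 0" using e(1) \<open>t < 1\<close> by simp
    ultimately show ?thesis by blast
  qed
  moreover have "(1 - t) *\<^sub>R x + t *\<^sub>R y \<in> P" using assms xP by (intro convexD) auto
  ultimately show ?thesis by (simp add: relcor_def)
qed

lemma convex_relcor:
  assumes "convex P"
  shows "convex (relcor V P)"
  unfolding convex_alt
proof (intro ballI allI impI)
  fix x y and u :: real assume *: "x \<in> relcor V P" "y \<in> relcor V P" "0 \<le> u \<and> u \<le> 1"
  then have "y \<in> P" by (simp add: relcor_def)
  then show "(1 - u) *\<^sub>R x + u *\<^sub>R y \<in> relcor V P"
    using relcor_segment[OF assms *(1)] * by (cases "u = 1") auto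
qed

text \<open>Going only half of the admissible distance \<epsilon> along \<open>v\<close> stays
  strictly before the endpoint \<open>x + \<epsilon> *\<^sub>R v\<close> of \<open>P\<close>, so
  \<open>relcor_segment\<close> applies.\<close>

lemma relcor_relcor:
  assumes "convex P"
  shows "relcor V (relcor V P) = relcor V P"
proof
  show "relcor V P \<subseteq> relcor V (relcor V P)"
  proof
    fix x assume x: "x \<in> relcor V P"
    have "\<exists>\<epsilon>>0. \<forall>t\<in>{0..\<epsilon>}. x + t *\<^sub>R v \<in> relcor V P" if "v \<in> V" for v
    proof -
      obtain \<epsilon> where e: "\<epsilon> > 0" "\<forall>t\<in>{0..\<epsilon>}. x + t *\<^sub>R v \<in> P"
        using x \<open>v \<in> V\<close> unfolding relcor_def by blast
      have "x + t *\<^sub>R v \<in> relcor V P" if t: "t \<in> {0..\<epsilon> / 2}" for t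
      proof -
        have "(1 - t / \<epsilon>) *\<^sub>R x + (t / \<epsilon>) *\<^sub>R (x + \<epsilon> *\<^sub>R v) \<in> relcor V P"
          using e t by (intro relcor_segment[OF assms x]) (auto simp: field_simps)
        also have "(1 - t / \<epsilon>) *\<^sub>R x + (t / \<epsilon>) *\<^sub>R (x + \<epsilon> *\<^sub>R v) = x + t *\<^sub>R v"
          using e(1) by (simp add: algebra_simps)
        finally show ?thesis .
      qed
      then show ?thesis using e(1) by (intro exI[of _ "\<epsilon> / 2"]) auto
    qed
    then show "x \<in> relcor V (relcor V P)" using x by (subst relcor_def) blast
  qed
qed (auto simp: relcor_def)

text \<open>A direction \<open>v + w\<close> is realised by moving \<open>p\<close> along
  \<open>v\<close> and \<open>q\<close> along \<open>- w\<close>; the sign is why \<open>W\<close>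
  is taken to be a subspace.\<close>

lemma diff_in_relcor:
  assumes p: "p \<in> relcor V P" and q: "q \<in> relcor W Q" and "subspace W"
  shows "p - q \<in> relcor {v + w |v w. v \<in> V \<and> w \<in> W} (\<Union>x\<in>P. \<Union>y\<in>Q. {x - y})"
    (is "_ \<in> relcor ?U ?D")
proof -
  have "\<exists>\<epsilon>>0. \<forall>t\<in>{0..\<epsilon>}. p - q + t *\<^sub>R u \<in> ?D" if "u \<in> ?U" for u
  proof -
    obtain v w where u: "u = v + w" "v \<in> V" "w \<in> W" using \<open>u \<in> ?U\<close> by blast
    obtain d where d: "d > 0" "\<forall>t\<in>{0..d}. p + t *\<^sub>R v \<in> P"
      using p u(2) unfolding relcor_def by blast
    have "- w \<in> W" using u(3) \<open>subspace W\<close> by (simp add: subspace_neg)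
    then obtain e where e: "e > 0" "\<forall>t\<in>{0..e}. q + t *\<^sub>R (- w) \<in> Q"
      using q unfolding relcor_def by blast
    have "p - q + t *\<^sub>R u \<in> ?D" if "t \<in> {0..min d e}" for t
    proof -
      have "p - q + t *\<^sub>R u = (p + t *\<^sub>R v) - (q + t *\<^sub>R (- w))"
        by (simp add: u algebra_simps)
      then show ?thesis using d(2) e(2) that by fastforce
    qed
    then show ?thesis using d(1) e(1) by (intro exI[of _ "min d e"]) auto
  qed
  moreover have "p - q \<in> ?D" using p q by (auto simp: relcor_def)
  ultimately show ?thesis by (simp add: relcor_def)
qed

text \<open>The limit as \<open>t\<close> tends to 1; it carries an inequality from relative cores
  over to the full convex sets.\<close>

lemma nonneg_endpoint:
  fixes a b :: real
  assumes "\<And>t. 0 \<le> t \<Longrightarrow> t < 1 \<Longrightarrow> 0 \<le> (1 - t) * a + t * b"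
  shows "0 \<le> b"
proof (rule tendsto_lowerbound)
  have "((\<lambda>t. (1 - t) * a + t * b) \<longlongrightarrow> (1 - 1) * a + 1 * b) (at_left 1)"
    by (intro tendsto_intros)
  then show "((\<lambda>t. (1 - t) * a + t * b) \<longlongrightarrow> b) (at_left 1)" by simp
  show "\<forall>\<^sub>F t in at_left 1. 0 \<le> (1 - t) * a + t * b"
    by (rule eventually_mono[OF eventually_at_left_real[OF zero_less_one]]) (auto intro: assms)
qed simp

section \<open>Separation of two convex sets\<close>

text \<open>The differences of the two relative cores form a convex set without \<open>0\<close>.
  The last two hypotheses place it in a single translate of \<open>V + W\<close>, even when one of
  the subspaces is \<open>{0}\<close>.\<close>

lemma separation_relcor:
  fixes P Q :: "'a::real_vector set"
  assumes "convex P" "convex Q" "subspace V" "subspace W"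
    and ne: "relcor V P \<noteq> {}" "relcor W Q \<noteq> {}"
    and disj: "relcor V P \<inter> relcor W Q = {}"
    and P_diff: "\<forall>x\<in>P. \<forall>y\<in>P. \<exists>v\<in>V. \<exists>w\<in>W. x - y = v + w"
    and Q_diff: "\<forall>x\<in>Q. \<forall>y\<in>Q. \<exists>v\<in>V. \<exists>w\<in>W. x - y = v + w"
  obtains f :: "'a \<Rightarrow> real"
  where "linear f" "f \<noteq> (\<lambda>_. 0)" "\<forall>p\<in>P. \<forall>q\<in>Q. f q \<le> f p"
proof -
  define U where "U = {v + w |v w. v \<in> V \<and> w \<in> W}"
  have U: "subspace U" unfolding U_def using assms by (intro subspace_sums)
  define D where "D = (\<Union>x\<in>relcor V P. \<Union>y\<in>relcor W Q. {x - y})"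
  obtain p0 q0 where p0: "p0 \<in> relcor V P" and q0: "q0 \<in> relcor W Q" using ne by blast
  \<comment> \<open>\<open>D\<close> is built from the cores, so \<open>p0\<close> and
    \<open>q0\<close> must be relatively interior to the cores themselves;
    \<open>relcor_relcor\<close> supplies this.\<close>
  have "p0 - q0 \<in> relcor U D"
    unfolding U_def D_def using p0 q0 assms by (intro diff_in_relcor) (auto simp: relcor_relcor)
  moreover have "p0 - q0 \<in> D" using p0 q0 by (auto simp: D_def)
  moreover have "convex D"
    unfolding D_def using assms by (intro convex_differences convex_relcor)
  moreover have "0 \<notin> D" using disj by (auto simp: D_def)
  moreover have "d - (p0 - q0) \<in> U" if "d \<in> D" for d
  proof -
    obtain p q where d: "d = p - q" "p \<in> P" "q \<in> Q"
      using \<open>d \<in> D\<close> unfolding D_def relcor_def by blast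
    have "p - p0 \<in> U" using P_diff d p0 unfolding U_def relcor_def by blast
    moreover have "q - q0 \<in> U" using Q_diff d q0 unfolding U_def relcor_def by blast
    ultimately have "(p - p0) - (q - q0) \<in> U" using U subspace_diff by blast
    then show ?thesis by (simp add: d(1) algebra_simps)
  qed
  ultimately obtain f :: "'a \<Rightarrow> real"
    where f: "linear f" "f \<noteq> (\<lambda>_. 0)" and f_D: "\<And>x. x \<in> D \<Longrightarrow> 0 \<le> f x"
    using linear_functional_of_relatively_open_convex[OF _ _ _ U] by metis
  note f_simps = linear_add[OF f(1)] linear_diff[OF f(1)] linear_scale[OF f(1)]
  have "f q \<le> f p" if "p \<in> P" "q \<in> Q" for p q
  proof -
    \<comment> \<open>Both points slide simultaneously from \<open>p0\<close> and \<open>q0\<close>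
      towards \<open>p\<close> and \<open>q\<close>, remaining in the cores for
      \<open>t < 1\<close>.\<close>
    have "0 \<le> (1 - t) * (f p0 - f q0) + t * (f p - f q)" if t: "0 \<le> t" "t < 1" for t
    proof -
      have "((1 - t) *\<^sub>R p0 + t *\<^sub>R p) - ((1 - t) *\<^sub>R q0 + t *\<^sub>R q) \<in> D"
        unfolding D_def
        using relcor_segment[OF \<open>convex P\<close> p0 \<open>p \<in> P\<close> t]
          relcor_segment[OF \<open>convex Q\<close> q0 \<open>q \<in> Q\<close> t] by blast
      from f_D[OF this] show ?thesis by (simp add: f_simps algebra_simps)
    qed
    then have "0 \<le> f p - f q" by (rule nonneg_endpoint)
    then show ?thesis by simp
  qed
  then show thesis using that f by blast
qed

section \<open>Normlike-bases and the passage to cones\<close>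

lemma normlike_base_nonempty:
  assumes \<psi>: "seminorm \<psi>" and "nontrivial_cone K" "has_normlike_base \<psi> K"
  shows "normlike_base \<psi> K \<noteq> {}"
proof -
  obtain x where x: "x \<in> K" "x \<noteq> 0" using assms by (auto simp: nontrivial_cone_def)
  then have "0 < \<psi> x" using assms by (simp add: has_normlike_base_def)
  then have "(1 / \<psi> x) *\<^sub>R x \<in> normlike_base \<psi> K"
    using assms x by (simp add: normlike_base_def seminorm_def nontrivial_cone_def cone_def)
  then show ?thesis by blast
qed

text \<open>Rescaling a nonzero \<open>x\<close> to \<psi>-value 1 reduces the claim to the base.
  The sign of \<alpha> is left free so that the lemma serves \<open>A\<close> with \<alpha> and
  \<open>K\<close> with \<open>- \<alpha>\<close>.\<close>

lemma cone_nonneg_of_normlike_base: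
  assumes \<psi>: "seminorm \<psi>" and "nontrivial_cone K" "has_normlike_base \<psi> K" "linear f"
    and base: "\<And>x. x \<in> normlike_base \<psi> K \<Longrightarrow> 0 \<le> f x + \<alpha>" and "x \<in> K"
  shows "0 \<le> f x + \<alpha> * \<psi> x"
proof (cases "x = 0")
  case True
  have "\<psi> 0 = 0" using \<psi> unfolding seminorm_def by (metis mult_zero_left order_refl scaleR_zero_left)
  then show ?thesis using True \<open>linear f\<close> by (simp add: linear_0)
next
  case False
  then have pos: "0 < \<psi> x" using assms by (simp add: has_normlike_base_def)
  then have "(1 / \<psi> x) *\<^sub>R x \<in> normlike_base \<psi> K"
    using assms by (simp add: normlike_base_def seminorm_def nontrivial_cone_def cone_def)
  from base[OF this] have "0 \<le> f x / \<psi> x + \<alpha>"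
    using \<open>linear f\<close> by (simp add: linear_scale)
  then show ?thesis using pos by (simp add: field_simps)
qed

theorem theorem5p1:
  fixes \<psi> :: "'a::real_vector \<Rightarrow> real" and K A :: "'a set"
  assumes "seminorm \<psi>"
    and "nontrivial_cone K" and "has_normlike_base \<psi> K"
    and "nontrivial_cone A" and "has_normlike_base \<psi> A"
    and "(solid (S_neg \<psi> K) \<and> S_zero \<psi> A \<inter> cor (S_neg \<psi> K) = {}) \<or>
         (solid (S_zero \<psi> A) \<and> cor (S_zero \<psi> A) \<inter> S_neg \<psi> K = {}) \<or>
         (relatively_solid (S_neg \<psi> K) \<and> relatively_solid (S_zero \<psi> A) \<and>
          icor (S_zero \<psi> A) \<inter> icor (S_neg \<psi> K) = {})"
  shows "\<exists>(x', \<alpha>) \<in> aug_dual_cone \<psi> K. x' \<noteq> (\<lambda>_. 0) \<and>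
           (\<forall>a \<in> A. \<forall>k \<in> uminus ` K.
              x' a + \<alpha> * \<psi> a \<ge> 0 \<and> 0 \<ge> x' k + \<alpha> * \<psi> k)"
proof -
  define P where "P = S_zero \<psi> A"
  define Q where "Q = S_neg \<psi> K"
  have conv: "convex P" "convex Q" by (simp_all add: P_def Q_def S_zero_def S_neg_def)
  have base: "- x \<in> Q" if "x \<in> normlike_base \<psi> K" for x
    using that by (simp add: Q_def S_neg_def hull_inc)
  have base': "x \<in> P" if "x \<in> normlike_base \<psi> A" for x
    using that by (simp add: P_def S_zero_def hull_inc)
  have "0 \<in> P" by (simp add: P_def S_zero_def hull_inc)
  obtain q0 where "q0 \<in> Q" using normlike_base_nonempty assms base by blast
  obtain V W where "subspace V" "subspace W" "relcor V P \<noteq> {}" "relcor W Q \<noteq> {}"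
    "relcor V P \<inter> relcor W Q = {}"
    "\<forall>x\<in>P. \<forall>y\<in>P. \<exists>v\<in>V. \<exists>w\<in>W. x - y = v + w"
    "\<forall>x\<in>Q. \<forall>y\<in>Q. \<exists>v\<in>V. \<exists>w\<in>W. x - y = v + w"
  proof -
    define V where "V = affine hull {y - z |y z. y \<in> P \<and> z \<in> P}"
    define W where "W = affine hull {y - z |y z. y \<in> Q \<and> z \<in> Q}"
    have VW: "subspace V" "subspace W"
      unfolding V_def W_def using \<open>0 \<in> P\<close> \<open>q0 \<in> Q\<close>
      by (auto intro!: subspace_affine_hull_differences)
    have "x - y \<in> V" if "x \<in> P" "y \<in> P" for x y
      unfolding V_def using that by (intro hull_inc) blast
    then have V: "\<exists>v\<in>V. \<exists>w\<in>W. x - y = v + w" if "x \<in> P" "y \<in> P" for x y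
      using that subspace_0[OF VW(2)] by (intro bexI[of _ "x - y"] bexI[of _ 0]) auto
    have "x - y \<in> W" if "x \<in> Q" "y \<in> Q" for x y
      unfolding W_def using that by (intro hull_inc) blast
    then have W: "\<exists>v\<in>V. \<exists>w\<in>W. x - y = v + w" if "x \<in> Q" "y \<in> Q" for x y
      using that subspace_0[OF VW(1)] by (intro bexI[of _ 0] bexI[of _ "x - y"]) auto
    have "relcor UNIV Q \<noteq> {} \<and> P \<inter> relcor UNIV Q = {} \<or>
        relcor UNIV P \<noteq> {} \<and> relcor UNIV P \<inter> Q = {} \<or>
        relcor W Q \<noteq> {} \<and> relcor V P \<noteq> {} \<and> relcor V P \<inter> relcor W Q = {}"
      using assms(6) unfolding solid_def relatively_solid_def cor_eq_relcor icor_eq_relcor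
      by (simp only: P_def Q_def V_def W_def)
    then show thesis
    proof (elim disjE conjE)
      \<comment> \<open>With \<open>{0}\<close> on one side and \<open>UNIV\<close> on the other,
        the conditions on differences are trivial, and the set paired with \<open>{0}\<close> is its
        own relative core.\<close>
      assume "relcor UNIV Q \<noteq> {}" "P \<inter> relcor UNIV Q = {}"
      then show thesis
        using \<open>0 \<in> P\<close> by (intro that[of "{0}" UNIV]) auto
    next
      assume "relcor UNIV P \<noteq> {}" "relcor UNIV P \<inter> Q = {}"
      then show thesis
        using \<open>q0 \<in> Q\<close> by (intro that[of UNIV "{0}"]) auto
    next
      assume "relcor W Q \<noteq> {}" "relcor V P \<noteq> {}" "relcor V P \<inter> relcor W Q = {}"
      then show thesis
        using V W VW by (intro that[of V W]) auto
    qed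
  qed
  then obtain f :: "'a \<Rightarrow> real"
    where f: "linear f" "f \<noteq> (\<lambda>_. 0)" and sep: "\<forall>p\<in>P. \<forall>q\<in>Q. f q \<le> f p"
    by (rule separation_relcor[OF conv])
  define \<alpha> where "\<alpha> = - Inf (f ` P)"
  \<comment> \<open>Any value of \<open>f\<close> on \<open>Q\<close> is a lower bound, hence the
    need for a point \<open>q0\<close>.\<close>
  have bdd: "bdd_below (f ` P)" using sep \<open>q0 \<in> Q\<close> by (intro bdd_belowI2[of _ "f q0"]) auto
  have P_ge: "0 \<le> f p + \<alpha>" if "p \<in> P" for p
    using cINF_lower[OF bdd that] by (simp add: \<alpha>_def)
  have Q_le: "f q + \<alpha> \<le> 0" if "q \<in> Q" for q
    using cINF_greatest[of P "f q" f] sep that \<open>0 \<in> P\<close> by (auto simp: \<alpha>_def)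
  have "0 \<le> \<alpha>" using P_ge[OF \<open>0 \<in> P\<close>] f(1) by (simp add: linear_0)
  have A_ge: "0 \<le> f a + \<alpha> * \<psi> a" if "a \<in> A" for a
    using cone_nonneg_of_normlike_base[OF assms(1,4,5) f(1) _ that] P_ge base' by blast
  \<comment> \<open>Base points of \<open>K\<close> enter \<open>Q\<close> with a minus sign, so
    \<open>f q + \<alpha> \<le> 0\<close> at \<open>q = - x\<close> becomes
    \<open>0 \<le> f x - \<alpha>\<close>.\<close>
  have K_ge: "\<alpha> * \<psi> k \<le> f k" if "k \<in> K" for k
    using cone_nonneg_of_normlike_base[OF assms(1-3) f(1) _ that, of "- \<alpha>"] Q_le base f(1)
    by (fastforce simp: linear_neg)
  \<comment> \<open>The same homogeneity lemma with the zero functional and constant 1.\<close>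
  have "0 \<le> \<psi> k" if "k \<in> K" for k
    using cone_nonneg_of_normlike_base[OF assms(1-3) linear_zero _ that, of 1] by simp
  then have "0 \<le> f k" if "k \<in> K" for k
    using K_ge[OF that] \<open>0 \<le> \<alpha>\<close> that by (meson mult_nonneg_nonneg order_trans)
  then have "(f, \<alpha>) \<in> aug_dual_cone \<psi> K"
    using f(1) K_ge \<open>0 \<le> \<alpha>\<close> by (simp add: aug_dual_cone_def dual_cone_def algebraic_dual_def)
  moreover have "f (- k) + \<alpha> * \<psi> (- k) \<le> 0" if "k \<in> K" for k
    using K_ge[OF that] assms(1) f(1) by (simp add: seminorm_def linear_neg)
  ultimately show ?thesis using f(2) A_ge by (intro bexI[of _ "(f, \<alpha>)"]) auto
qed

end
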